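(* Let $k$ be an algebraically closed field, let $R=k[x_1,\ldots,x_n]$, let $X\subseteq k^n$, and let $\nu:X\to\mathbb{N}_{>0}$ be bounded. Then, for every prime ideal $P\in\operatorname{Spec}(R)$, the following conditions are equivalent: (1) $\Phi^{*}_{X,\nu}(P)=P$; (2) $\mathcal{I}\bigl(X\cap V_{\mathrm{aff}}(P)\bigr)=P$; (3) the Zariski closure of $X\cap V_{\mathrm{aff}}(P)$ in $k^n$ equals $V_{\mathrm{aff}}(P)$. Consequently, $$\operatorname{Spec}_{\Phi_{X,\nu}}(R)=\{P\in\operatorname{Spec}(R): X\cap V_{\mathrm{aff}}(P)\text{ is Zariski dense in }V_{\mathrm{aff}}(P)\}.$$
   Context: For $a=(a_1,\ldots,a_n)\in k^n$, $\mathfrak{m}_a=(x_1-a_1,\ldots,x_n-a_n)\subseteq R$. For an ideal $I$ of $R$, $V_{\mathrm{aff}}(I)=\{a\in k^n: f(a)=0\text{ for every }f\in I\}$. For $Y\subseteq k^n$, $\mathcal{I}(Y)=\{f\in R: f(a)=0\text{ for every }a\in Y\}$; in particular $\mathcal{I}(\varnothing)=R$. For every subset $A\subseteq R$, $$\Phi^{*}_{X,\nu}(A)=\bigcap_{a\in X}\bigl(A+\mathfrak{m}_a^{\nu(a)}\bigr),$$ where the intersection is $R$ if $X=\varnothing$. The function $\nu$ is bounded if there is a positive integer $N$ with $\nu(a)\le N$ for every $a\in X$. The fixed-prime spectrum is $\operatorname{Spec}_{\Phi_{X,\nu}}(R)=\{P\in\operatorname{Spec}(R):\Phi^{*}_{X,\nu}(P)=P\}$.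 *)

theory Defs
  imports
    "HOL-Library.Poly_Mapping"
    "HOL-Library.FuncSet"
    "HOL-Computational_Algebra.Polynomial"
    "HOL-Algebra.Ideal_Product"
    "HOL-Analysis.Abstract_Topology"
begin

section \<open>The polynomial ring and its evaluation\<close>

text \<open>
  A monomial is a finitely supported exponent function \<open>nat \<Rightarrow>\<^sub>0 nat\<close>, and a polynomial is a finitely
  supported function from monomials to coefficients. The variables are numbered from \<open>0\<close>, so
  \<open>k[x\<^sub>1,\<dots>,x\<^sub>n]\<close> consists of the polynomials in which only variables with index below \<open>n\<close> occur.
\<close>

type_synonym 'k mpoly = "(nat \<Rightarrow>\<^sub>0 nat) \<Rightarrow>\<^sub>0 'k"

definition mpoly_var :: "nat \<Rightarrow> 'k::comm_ring_1 mpoly" where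
  "mpoly_var i = Poly_Mapping.single (Poly_Mapping.single i 1) 1"

definition mpoly_const :: "'k \<Rightarrow> 'k::comm_ring_1 mpoly" where
  "mpoly_const c = Poly_Mapping.single 0 c"

definition monom_eval :: "(nat \<Rightarrow> 'k) \<Rightarrow> (nat \<Rightarrow>\<^sub>0 nat) \<Rightarrow> 'k::comm_ring_1" where
  "monom_eval a m = (\<Prod>i\<in>Poly_Mapping.keys m. a i ^ Poly_Mapping.lookup m i)"

definition mpoly_eval :: "(nat \<Rightarrow> 'k) \<Rightarrow> 'k mpoly \<Rightarrow> 'k::comm_ring_1" where
  "mpoly_eval a p = (\<Sum>m\<in>Poly_Mapping.keys p. Poly_Mapping.lookup p m * monom_eval a m)"

definition mpoly_ring :: "nat \<Rightarrow> 'k::comm_ring_1 mpoly ring" where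
  "mpoly_ring n =
    \<lparr>carrier = {p. \<forall>m\<in>Poly_Mapping.keys p. Poly_Mapping.keys m \<subseteq> {..<n}},
     mult = (*), one = 1, zero = 0, add = (+)\<rparr>"

section \<open>Affine space, zero loci and vanishing ideals\<close>

text \<open>Points of \<open>k\<^sup>n\<close> are functions on \<open>{..<n}\<close>, extended by \<^const>\<open>undefined\<close>.\<close>

definition affine_space :: "nat \<Rightarrow> (nat \<Rightarrow> 'k) set" where
  "affine_space n = {..<n} \<rightarrow>\<^sub>E UNIV"

definition V_aff :: "nat \<Rightarrow> 'k::comm_ring_1 mpoly set \<Rightarrow> (nat \<Rightarrow> 'k) set" where
  "V_aff n I = {a \<in> affine_space n. \<forall>f\<in>I. mpoly_eval a f = 0}"

definition vanishing_ideal :: "nat \<Rightarrow> (nat \<Rightarrow> 'k) set \<Rightarrow> 'k::comm_ring_1 mpoly set" where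
  "vanishing_ideal n Y = {f \<in> carrier (mpoly_ring n). \<forall>a\<in>Y. mpoly_eval a f = 0}"

definition point_ideal :: "nat \<Rightarrow> (nat \<Rightarrow> 'k) \<Rightarrow> 'k::comm_ring_1 mpoly set" where
  "point_ideal n a = Idl\<^bsub>mpoly_ring n\<^esub> ((\<lambda>i. mpoly_var i - mpoly_const (a i)) ` {..<n})"

text \<open>The fact \<open>openin_zariski\<close> below shows that these sets do form a topology.\<close>

definition zariski :: "nat \<Rightarrow> (nat \<Rightarrow> 'k::comm_ring_1) topology" where
  "zariski n = topology (\<lambda>U. \<exists>I. ideal I (mpoly_ring n) \<and> U = affine_space n - V_aff n I)"

definition zariski_dense_in :: "nat \<Rightarrow> (nat \<Rightarrow> 'k::comm_ring_1) set \<Rightarrow> (nat \<Rightarrow> 'k) set \<Rightarrow> bool" where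
  "zariski_dense_in n Y Z \<longleftrightarrow> Y \<subseteq> Z \<and> subtopology (zariski n) Z closure_of Y = Z"

section \<open>The closure operator and its fixed primes\<close>

text \<open>
  Powers of ideals are taken in the monoid \<^const>\<open>ideals_set\<close> of ideals under the ideal product.
  Intersecting with the carrier matters only for \<open>X = {}\<close>, where the result is the whole ring.
\<close>

definition Phi_star ::
  "nat \<Rightarrow> (nat \<Rightarrow> 'k) set \<Rightarrow> ((nat \<Rightarrow> 'k) \<Rightarrow> nat) \<Rightarrow> 'k mpoly set \<Rightarrow> 'k::comm_ring_1 mpoly set" where
  "Phi_star n X \<nu> A = carrier (mpoly_ring n) \<inter>
     (\<Inter>a\<in>X. A <+>\<^bsub>mpoly_ring n\<^esub> (point_ideal n a [^]\<^bsub>ideals_set (mpoly_ring n)\<^esub> \<nu> a))"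

definition Spec :: "('a, 'b) ring_scheme \<Rightarrow> 'a set set" where
  "Spec R = {P. primeideal P R}"

definition Spec_Phi ::
  "nat \<Rightarrow> (nat \<Rightarrow> 'k) set \<Rightarrow> ((nat \<Rightarrow> 'k) \<Rightarrow> nat) \<Rightarrow> 'k::comm_ring_1 mpoly set set" where
  "Spec_Phi n X \<nu> = {P \<in> Spec (mpoly_ring n). Phi_star n X \<nu> P = P}"

section \<open>Well-definedness\<close>

lemma mpoly_ring_simps [simp]:
  "mult (mpoly_ring n) = (*)" "one (mpoly_ring n) = 1"
  "zero (mpoly_ring n) = 0" "add (mpoly_ring n) = (+)"
  by (simp_all add: mpoly_ring_def)

lemma mpoly_ring_carrier:
  "p \<in> carrier (mpoly_ring n) \<longleftrightarrow> (\<forall>m\<in>Poly_Mapping.keys p. Poly_Mapping.keys m \<subseteq> {..<n})"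
  by (simp add: mpoly_ring_def)

lemma cring_mpoly_ring: "cring (mpoly_ring n :: 'k::comm_ring_1 mpoly ring)"
proof (rule cringI)
  have add: "p + q \<in> carrier (mpoly_ring n)"
    if "p \<in> carrier (mpoly_ring n)" "q \<in> carrier (mpoly_ring n)" for p q :: "'k mpoly"
    using that Poly_Mapping.keys_add[of p q] unfolding mpoly_ring_carrier by blast
  have uminus: "- p \<in> carrier (mpoly_ring n)"
    if "p \<in> carrier (mpoly_ring n)" for p :: "'k mpoly"
    using that by (simp add: mpoly_ring_carrier in_keys_iff)
  show "abelian_group (mpoly_ring n :: 'k mpoly ring)"
  proof (rule abelian_groupI)
    fix p :: "'k mpoly" assume "p \<in> carrier (mpoly_ring n)"
    then show "\<exists>q\<in>carrier (mpoly_ring n). q \<oplus>\<^bsub>mpoly_ring n\<^esub> p = \<zero>\<^bsub>mpoly_ring n\<^esub>"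
      using uminus by (intro bexI[of _ "- p"]) auto
  next
    fix p q :: "'k mpoly"
    assume "p \<in> carrier (mpoly_ring n)" "q \<in> carrier (mpoly_ring n)"
    then show "p \<oplus>\<^bsub>mpoly_ring n\<^esub> q \<in> carrier (mpoly_ring n)"
      by (simp add: add)
  qed (auto simp: algebra_simps mpoly_ring_carrier)
  have mult: "p * q \<in> carrier (mpoly_ring n)"
    if "p \<in> carrier (mpoly_ring n)" "q \<in> carrier (mpoly_ring n)" for p q :: "'k mpoly"
    unfolding mpoly_ring_carrier
  proof
    fix m assume "m \<in> Poly_Mapping.keys (p * q)"
    then obtain s t where "m = s + t" "s \<in> Poly_Mapping.keys p" "t \<in> Poly_Mapping.keys q"
      using Poly_Mapping.keys_mult[of p q] by blast
    with that Poly_Mapping.keys_add[of s t] show "Poly_Mapping.keys m \<subseteq> {..<n}"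
      unfolding mpoly_ring_carrier by blast
  qed
  show "comm_monoid (mpoly_ring n :: 'k mpoly ring)"
    by (rule comm_monoidI) (auto simp: mult algebra_simps, auto simp: mpoly_ring_carrier)
qed (auto simp: algebra_simps)

lemma monom_eval_superset:
  assumes "finite S" "Poly_Mapping.keys m \<subseteq> S"
  shows "monom_eval a m = (\<Prod>i\<in>S. a i ^ Poly_Mapping.lookup m i)"
  unfolding monom_eval_def using assms
  by (intro prod.mono_neutral_left) (auto simp: in_keys_iff)

lemma monom_eval_add: "monom_eval a (s + t) = monom_eval a s * monom_eval a t"
proof -
  define S where "S = Poly_Mapping.keys s \<union> Poly_Mapping.keys t"
  have "finite S" "Poly_Mapping.keys (s + t) \<subseteq> S" "Poly_Mapping.keys s \<subseteq> S" "Poly_Mapping.keys t \<subseteq> S"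
    using Poly_Mapping.keys_add[of s t] by (auto simp: S_def)
  then show ?thesis
    by (simp add: monom_eval_superset lookup_add power_add prod.distrib)
qed

lemma mpoly_eval_superset:
  assumes "finite S" "Poly_Mapping.keys p \<subseteq> S"
  shows "mpoly_eval a p = (\<Sum>m\<in>S. Poly_Mapping.lookup p m * monom_eval a m)"
  unfolding mpoly_eval_def using assms
  by (intro sum.mono_neutral_left) (auto simp: in_keys_iff)

lemma mpoly_eval_zero [simp]: "mpoly_eval a 0 = 0"
  by (simp add: mpoly_eval_def)

lemma mpoly_eval_add [simp]: "mpoly_eval a (p + q) = mpoly_eval a p + mpoly_eval a q"
proof -
  define S where "S = Poly_Mapping.keys p \<union> Poly_Mapping.keys q"
  have "finite S" "Poly_Mapping.keys (p + q) \<subseteq> S" "Poly_Mapping.keys p \<subseteq> S" "Poly_Mapping.keys q \<subseteq> S"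
    using Poly_Mapping.keys_add[of p q] by (auto simp: S_def)
  then show ?thesis
    by (simp add: mpoly_eval_superset lookup_add algebra_simps sum.distrib)
qed

lemma mpoly_eval_sum: "mpoly_eval a (\<Sum>i\<in>S. f i) = (\<Sum>i\<in>S. mpoly_eval a (f i))"
  by (induction S rule: infinite_finite_induct) auto

lemma mpoly_eval_single [simp]: "mpoly_eval a (Poly_Mapping.single m c) = c * monom_eval a m"
  by (cases "c = 0") (auto simp: mpoly_eval_def)

lemma mpoly_eval_uminus [simp]: "mpoly_eval a (- p) = - mpoly_eval a p"
  by (metis mpoly_eval_add mpoly_eval_zero add.right_inverse add_eq_0_iff)

lemma mpoly_eval_diff [simp]: "mpoly_eval a (p - q) = mpoly_eval a p - mpoly_eval a q"
  using mpoly_eval_add[of a p "- q"] by simp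

lemma mpoly_expand:
  "p = (\<Sum>m\<in>Poly_Mapping.keys p. Poly_Mapping.single m (Poly_Mapping.lookup p m))"
  by (rule poly_mapping_eqI)
     (auto simp: lookup_sum lookup_single when_def in_keys_iff)

lemma mpoly_eval_mult [simp]: "mpoly_eval a (p * q) = mpoly_eval a p * mpoly_eval a q"
proof -
  have "p * q = (\<Sum>s\<in>Poly_Mapping.keys p. \<Sum>t\<in>Poly_Mapping.keys q.
      Poly_Mapping.single (s + t) (Poly_Mapping.lookup p s * Poly_Mapping.lookup q t))"
    by (subst mpoly_expand[of p], subst mpoly_expand[of q])
       (simp add: sum_product mult_single)
  then have "mpoly_eval a (p * q) = (\<Sum>s\<in>Poly_Mapping.keys p. \<Sum>t\<in>Poly_Mapping.keys q.
      Poly_Mapping.lookup p s * Poly_Mapping.lookup q t * (monom_eval a s * monom_eval a t))"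
    by (simp add: mpoly_eval_sum monom_eval_add)
  also have "\<dots> = mpoly_eval a p * mpoly_eval a q"
    unfolding mpoly_eval_def by (simp add: sum_product algebra_simps)
  finally show ?thesis .
qed

lemma mpoly_eval_one [simp]: "mpoly_eval a 1 = 1"
  using mpoly_eval_single[of a 0 1] by (simp add: monom_eval_def del: mpoly_eval_single)

lemma mpoly_eval_const [simp]: "mpoly_eval a (mpoly_const c) = c"
  by (simp add: mpoly_const_def monom_eval_def)

lemma mpoly_eval_var [simp]: "mpoly_eval a (mpoly_var i) = a i"
  by (simp add: mpoly_var_def monom_eval_def)

lemma ideal_vanishing_ideal:
  fixes Y :: "(nat \<Rightarrow> 'k::comm_ring_1) set"
  shows "ideal (vanishing_ideal n Y) (mpoly_ring n)"
proof -
  interpret cring "mpoly_ring n :: 'k mpoly ring"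
    by (rule cring_mpoly_ring)
  show ?thesis
  proof (rule idealI)
    show "subgroup (vanishing_ideal n Y) (add_monoid (mpoly_ring n))"
    proof (rule add.subgroupI)
      fix f assume f: "f \<in> vanishing_ideal n Y"
      then have "f \<in> carrier (mpoly_ring n)" by (simp add: vanishing_ideal_def)
      moreover from this have "\<ominus>\<^bsub>mpoly_ring n\<^esub> f = - f"
        using l_neg[of f] by (simp add: add_eq_0_iff2)
      ultimately show "\<ominus>\<^bsub>mpoly_ring n\<^esub> f \<in> vanishing_ideal n Y"
        using f a_inv_closed[of f] by (auto simp: vanishing_ideal_def)
    next
      fix f g assume "f \<in> vanishing_ideal n Y" "g \<in> vanishing_ideal n Y"
      then show "f \<oplus>\<^bsub>mpoly_ring n\<^esub> g \<in> vanishing_ideal n Y"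
        using a_closed[of f g] by (auto simp: vanishing_ideal_def)
    next
      have "0 \<in> vanishing_ideal n Y"
        using zero_closed by (simp add: vanishing_ideal_def)
      then show "vanishing_ideal n Y \<noteq> {}" by blast
    qed (auto simp: vanishing_ideal_def)
  next
    fix f g :: "'k mpoly" assume "f \<in> vanishing_ideal n Y" "g \<in> carrier (mpoly_ring n)"
    then show "g \<otimes>\<^bsub>mpoly_ring n\<^esub> f \<in> vanishing_ideal n Y" "f \<otimes>\<^bsub>mpoly_ring n\<^esub> g \<in> vanishing_ideal n Y"
      using m_closed[of f g] m_closed[of g f] by (auto simp: vanishing_ideal_def)
  qed (rule ring_axioms)
qed

lemma V_aff_genideal:
  fixes S :: "'k::comm_ring_1 mpoly set"
  assumes "S \<subseteq> carrier (mpoly_ring n)"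
  shows "V_aff n (Idl\<^bsub>mpoly_ring n\<^esub> S) = V_aff n S"
proof -
  interpret cring "mpoly_ring n :: 'k mpoly ring"
    by (rule cring_mpoly_ring)
  have "S \<subseteq> Idl\<^bsub>mpoly_ring n\<^esub> S"
    using assms by (rule genideal_self)
  moreover have "Idl\<^bsub>mpoly_ring n\<^esub> S \<subseteq> vanishing_ideal n (V_aff n S)"
    using assms by (intro genideal_minimal ideal_vanishing_ideal)
      (auto simp: vanishing_ideal_def V_aff_def)
  ultimately show ?thesis
    by (auto simp: V_aff_def vanishing_ideal_def)
qed

lemma V_aff_Int:
  fixes I J :: "'k::idom mpoly set"
  assumes "ideal I (mpoly_ring n)" "ideal J (mpoly_ring n)"
  shows "V_aff n (I \<inter> J) = V_aff n I \<union> V_aff n J"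
proof -
  interpret I: ideal I "mpoly_ring n" by fact
  interpret J: ideal J "mpoly_ring n" by fact
  have "f * g \<in> I \<inter> J" if "f \<in> I" "g \<in> J" for f g
    using I.I_r_closed[OF that(1) J.Icarr[OF that(2)]] J.I_l_closed[OF that(2) I.Icarr[OF that(1)]]
    by simp
  then have "mpoly_eval a f = 0 \<or> mpoly_eval a g = 0"
    if "a \<in> V_aff n (I \<inter> J)" "f \<in> I" "g \<in> J" for a f g
    using that unfolding V_aff_def by (metis (mono_tags, lifting) mem_Collect_eq mpoly_eval_mult mult_eq_0_iff)
  then show ?thesis
    unfolding V_aff_def by blast
qed

lemma openin_zariski:
  fixes U :: "(nat \<Rightarrow> 'k::idom) set"
  shows "openin (zariski n) U \<longleftrightarrow> (\<exists>I. ideal I (mpoly_ring n) \<and> U = affine_space n - V_aff n I)"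
proof -
  let ?op = "\<lambda>U :: (nat \<Rightarrow> 'k) set. \<exists>I. ideal I (mpoly_ring n) \<and> U = affine_space n - V_aff n I"
  interpret cring "mpoly_ring n :: 'k mpoly ring"
    by (rule cring_mpoly_ring)
  have "istopology ?op"
    unfolding istopology_def
  proof (intro conjI allI impI)
    fix S T assume "?op S" "?op T"
    then obtain I J where IJ: "ideal I (mpoly_ring n)" "S = affine_space n - V_aff n I"
      "ideal J (mpoly_ring n)" "T = affine_space n - V_aff n J"
      by blast
    then have "S \<inter> T = affine_space n - V_aff n (I \<inter> J)"
      by (auto simp: V_aff_Int)
    with IJ show "?op (S \<inter> T)"
      by (intro exI[of _ "I \<inter> J"] conjI i_intersect)
  next
    fix \<U> assume "\<forall>U\<in>\<U>. ?op U"
    then obtain J where J: "\<forall>U\<in>\<U>. ideal (J U) (mpoly_ring n) \<and> U = affine_space n - V_aff n (J U)"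
      by (rule bchoice[THEN exE])
    have carr: "(\<Union>U\<in>\<U>. J U) \<subseteq> carrier (mpoly_ring n)"
    proof (rule UN_least)
      fix U assume "U \<in> \<U>"
      with J have "ideal (J U) (mpoly_ring n)" by simp
      then show "J U \<subseteq> carrier (mpoly_ring n)"
        by (intro subsetI) (rule ideal.Icarr)
    qed
    have "\<Union>\<U> = affine_space n - V_aff n (\<Union>U\<in>\<U>. J U)"
    proof -
      have "\<Union>\<U> = (\<Union>U\<in>\<U>. affine_space n - V_aff n (J U))"
        using J by auto
      also have "\<dots> = affine_space n - V_aff n (\<Union>U\<in>\<U>. J U)"
        by (auto simp: V_aff_def)
      finally show ?thesis .
    qed
    then show "?op (\<Union>\<U>)"
      using genideal_ideal[OF carr] V_aff_genideal[OF carr] by (intro exI[of _ "Idl\<^bsub>mpoly_ring n\<^esub> (\<Union>U\<in>\<U>. J U)"]) simp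
  qed
  then show ?thesis
    by (simp add: zariski_def)
qed

end

theory Submission
  imports Defs
begin

text \<open>
  Let \<open>Y = X \<inter> V(P)\<close>. Everything is compared with the vanishing ideal \<open>I(Y)\<close>.

  The inclusions \<open>P \<subseteq> \<Phi>\<^sup>*(P) \<subseteq> I(Y)\<close> always hold, the second one because \<open>P + \<mm>\<^sub>a\<^bsup>\<nu>(a)\<^esup>\<close> vanishes at \<open>a\<close>
  for every \<open>a \<in> Y\<close>. Conversely, if \<open>f\<close> vanishes on \<open>Y\<close> and \<open>N\<close> bounds \<open>\<nu>\<close>, then \<open>f\<^sup>N \<in> \<Phi>\<^sup>*(P)\<close>: for
  \<open>a \<in> Y\<close> we have \<open>f \<in> \<mm>\<^sub>a\<close>, and for \<open>a \<in> X\<close> outside \<open>V(P)\<close> the sum \<open>P + \<mm>\<^sub>a\<^bsup>\<nu>(a)\<^esup>\<close> is the whole ring. So a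
  prime that is fixed by \<open>\<Phi>\<^sup>*\<close> contains \<open>f\<^sup>N\<close> and hence \<open>f\<close>. This gives the equivalence with
  \<open>I(Y) = P\<close> (lemma \<open>Phi_star_fixed_iff\<close>).

  The closure of \<open>Y\<close> is \<open>V(I(Y))\<close>. Therefore \<open>I(Y) = P\<close> implies that \<open>Y\<close> has closure \<open>V(P)\<close>, and in
  the other direction \<open>I(Y) = I(V(P))\<close>, which is \<open>P\<close> by the Nullstellensatz for prime ideals (lemma
  \<open>nullstellensatz_prime\<close>). Algebraic closedness enters here.

  The Nullstellensatz is proved in the form: for every \<open>f\<close> outside a prime \<open>P\<close> there is a zero of \<open>P\<close> at
  which \<open>f\<close> does not vanish. The proof is an induction on the number of variables. Contract \<open>P\<close> to a
  prime \<open>Q\<close> in one variable less. There is an element \<open>g\<close> outside \<open>Q\<close> such that every zero of \<open>Q\<close> with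
  \<open>g \<noteq> 0\<close> extends to a zero of \<open>P\<close> with \<open>f \<noteq> 0\<close> (lemma \<open>extend_hom_past_variable\<close>); the induction
  hypothesis for \<open>Q\<close> and \<open>g\<close> supplies such a zero. The element \<open>g\<close> is found by pseudo-division with
  respect to a polynomial of least degree in \<open>P\<close> whose leading coefficient is not in \<open>Q\<close>.
\<close>

section \<open>Subrings of a ring type and their primes\<close>

text \<open>
  Subrings of a fixed ring type make \<open>k[x\<^sub>1,\<dots>,x\<^sub>n]\<close> a subset of \<open>k[x\<^sub>1,\<dots>,x\<^sub>n\<^sub>+\<^sub>1]\<close>, with the same
  operations, so that an induction on \<open>n\<close> needs no embeddings. The same two locales describe \<open>A[T]\<close>
  inside the type of polynomials.
\<close>
locale comm_subring =
  fixes A :: "'r::comm_ring_1 set"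
  assumes one_A: "1 \<in> A"
    and diff_A: "\<And>a b. a \<in> A \<Longrightarrow> b \<in> A \<Longrightarrow> a - b \<in> A"
    and mult_A: "\<And>a b. a \<in> A \<Longrightarrow> b \<in> A \<Longrightarrow> a * b \<in> A"
begin

lemma zero_A: "0 \<in> A"
  using diff_A[OF one_A one_A] by simp

lemma uminus_A: "a \<in> A \<Longrightarrow> - a \<in> A"
  using diff_A[OF zero_A] by fastforce

lemma add_A: "a \<in> A \<Longrightarrow> b \<in> A \<Longrightarrow> a + b \<in> A"
  using diff_A[OF _ uminus_A] by fastforce

lemma power_A: "a \<in> A \<Longrightarrow> a ^ m \<in> A"
  by (induction m) (auto intro: one_A mult_A)

lemma sum_A: "(\<And>i. i \<in> S \<Longrightarrow> f i \<in> A) \<Longrightarrow> sum f S \<in> A"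
  by (induction S rule: infinite_finite_induct) (auto intro: zero_A add_A)

end

locale prime_of_subring = comm_subring A for A :: "'r::comm_ring_1 set" +
  fixes P :: "'r set"
  assumes P_sub_A: "\<And>p. p \<in> P \<Longrightarrow> p \<in> A"
    and zero_P: "0 \<in> P"
    and add_P: "\<And>p q. p \<in> P \<Longrightarrow> q \<in> P \<Longrightarrow> p + q \<in> P"
    and mult_P: "\<And>a p. a \<in> A \<Longrightarrow> p \<in> P \<Longrightarrow> a * p \<in> P"
    and one_notin_P: "1 \<notin> P"
    and prime_P: "\<And>a b. a \<in> A \<Longrightarrow> b \<in> A \<Longrightarrow> a * b \<in> P \<Longrightarrow> a \<in> P \<or> b \<in> P"
begin

lemma sum_P: "(\<And>i. i \<in> S \<Longrightarrow> f i \<in> P) \<Longrightarrow> sum f S \<in> P"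
  by (induction S rule: infinite_finite_induct) (auto intro: zero_P add_P)

lemma uminus_P: "p \<in> P \<Longrightarrow> - p \<in> P"
  using mult_P[OF uminus_A[OF one_A]] by fastforce

lemma diff_P: "p \<in> P \<Longrightarrow> q \<in> P \<Longrightarrow> p - q \<in> P"
  using add_P[OF _ uminus_P] by fastforce

lemma mult_P': "p \<in> P \<Longrightarrow> a \<in> A \<Longrightarrow> p * a \<in> P"
  using mult_P[of a p] by (simp add: mult.commute)

lemma power_in_P_D: "a \<in> A \<Longrightarrow> a ^ m \<in> P \<Longrightarrow> a \<in> P"
  using one_notin_P prime_P power_A by (induction m) auto

lemma in_P_cong: "p - q \<in> P \<Longrightarrow> p \<in> P \<longleftrightarrow> q \<in> P"
  using diff_P[of p "p - q"] add_P[of "p - q" q] by auto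

end

section \<open>Polynomials over a subring and pseudo-division\<close>

definition polys_over :: "'r::comm_ring_1 set \<Rightarrow> 'r poly set" where
  "polys_over S = {p. \<forall>i. coeff p i \<in> S}"

lemma pCons_polys_over: "pCons c p \<in> polys_over S \<longleftrightarrow> c \<in> S \<and> p \<in> polys_over S"
  by (force simp: polys_over_def coeff_pCons split: nat.splits)

lemma (in comm_subring) poly_mult_closed:
  "p \<in> polys_over A \<Longrightarrow> q \<in> polys_over A \<Longrightarrow> p * q \<in> polys_over A"
  by (auto simp: polys_over_def coeff_mult intro!: sum_A mult_A)

text \<open>
  As \<open>A\<close> need not be a field, the dividend has to be multiplied by a power of the leading coefficient of
  the divisor. The degree bound on the quotient cannot be read off from the equation, because the
  ambient ring may have zero divisors.
\<close>
lemma (in comm_subring) pseudo_division: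
  assumes h: "h \<in> polys_over A" "degree h > 0"
    and p: "p \<in> polys_over A"
  shows "\<exists>m q r. q \<in> polys_over A \<and> r \<in> polys_over A \<and> degree q \<le> degree p - degree h \<and>
      degree r < degree h \<and> smult (lead_coeff h ^ m) p = q * h + r"
  using p
proof (induction "degree p" arbitrary: p rule: less_induct)
  case less
  show ?case
  proof (cases "degree p < degree h")
    case True
    have "0 \<in> polys_over A" by (simp add: polys_over_def zero_A)
    with True less.prems show ?thesis
      by (intro exI[of _ 0] exI[of _ p]) auto
  next
    case False
    define k where "k = degree p - degree h"
    define t where "t = monom (lead_coeff p) k"
    define p' where "p' = smult (lead_coeff h) p - t * h"
    have coeff_th: "coeff (t * h) i = (if i < k then 0 else lead_coeff p * coeff h (i - k))" for i
      by (simp add: t_def coeff_monom_mult not_less)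
    have "t \<in> polys_over A"
      using less.prems zero_A by (auto simp: t_def polys_over_def)
    have p'A: "p' \<in> polys_over A"
      using less.prems h(1) zero_A
      by (auto simp: p'_def polys_over_def coeff_th intro!: diff_A mult_A)
    have "degree p' \<le> degree p"
      unfolding p'_def t_def using False h(2) 
      by (intro degree_diff_le degree_smult_le order.trans[OF degree_mult_le])
         (auto simp: k_def intro!: order.trans[OF add_right_mono[OF degree_monom_le]])
    moreover have "coeff (t * h) (degree p) = lead_coeff p * lead_coeff h"
      using False by (simp add: coeff_th k_def)
    then have "coeff p' (degree p) = 0"
      by (simp add: p'_def)
    ultimately have "degree p' < degree p \<or> p' = 0"
      by (metis le_neq_implies_less leading_coeff_0_iff)
    then have deg: "degree p' < degree p"
      using False h(2) by auto
    from less.hyps[OF deg p'A] obtain m q r where qr: "q \<in> polys_over A" "r \<in> polys_over A"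
        "degree q \<le> degree p' - degree h" "degree r < degree h"
        "smult (lead_coeff h ^ m) p' = q * h + r"
      by blast
    define q' where "q' = q + smult (lead_coeff h ^ m) t"
    have "q' \<in> polys_over A"
      using qr(1) h(1) \<open>t \<in> _\<close> by (auto simp: q'_def polys_over_def intro!: add_A mult_A power_A)
    moreover have "degree q' \<le> degree p - degree h"
      unfolding q'_def using qr(3) deg
      by (intro degree_add_le order.trans[OF degree_smult_le]) (auto simp: t_def k_def degree_monom_le)
    moreover have "smult (lead_coeff h ^ Suc m) p = q' * h + r"
    proof -
      have "smult (lead_coeff h ^ Suc m) p = smult (lead_coeff h ^ m) (p' + t * h)"
        by (simp add: p'_def mult.commute)
      also have "\<dots> = q' * h + r"
        by (simp add: smult_add_right qr(5) q'_def algebra_simps)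
      finally show ?thesis .
    qed
    ultimately show ?thesis
      using qr by blast
  qed
qed

section \<open>Extending homomorphisms past one variable\<close>

locale comm_ring_1_hom =
  fixes \<phi> :: "'r::comm_ring_1 \<Rightarrow> 'k::comm_ring_1"
  assumes hom_1: "\<phi> 1 = 1"
    and hom_add: "\<phi> (a + b) = \<phi> a + \<phi> b"
    and hom_mult: "\<phi> (a * b) = \<phi> a * \<phi> b"
begin

lemma hom_0: "\<phi> 0 = 0"
  using hom_add[of 0 0] by simp

lemma hom_power: "\<phi> (a ^ m) = \<phi> a ^ m"
  by (induction m) (simp_all add: hom_1 hom_mult)

lemma poly_map_poly_pCons:
  "poly (map_poly \<phi> (pCons c p)) t = \<phi> c + t * poly (map_poly \<phi> p) t"
  by (simp add: map_poly_pCons hom_0)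

lemma poly_map_poly_add:
  "poly (map_poly \<phi> (p + q)) t = poly (map_poly \<phi> p) t + poly (map_poly \<phi> q) t"
proof -
  have "map_poly \<phi> (p + q) = map_poly \<phi> p + map_poly \<phi> q"
    by (rule poly_eqI) (simp add: coeff_map_poly hom_0 hom_add)
  then show ?thesis by simp
qed

lemma poly_map_poly_smult:
  "poly (map_poly \<phi> (smult c p)) t = \<phi> c * poly (map_poly \<phi> p) t"
proof -
  have "map_poly \<phi> (smult c p) = smult (\<phi> c) (map_poly \<phi> p)"
    by (rule poly_eqI) (simp add: coeff_map_poly hom_0 hom_mult)
  then show ?thesis by simp
qed

lemma poly_map_poly_mult:
  "poly (map_poly \<phi> (p * q)) t = poly (map_poly \<phi> p) t * poly (map_poly \<phi> q) t"
  by (induction p)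
     (simp_all add: poly_map_poly_pCons poly_map_poly_add poly_map_poly_smult hom_0 algebra_simps)

end

text \<open>
  A nonconstant \<open>p\<close> takes every value over an algebraically closed field, in particular the value \<open>1\<close>.
\<close>
lemma alg_closed_nonroot:
  fixes p :: "'k::alg_closed_field poly"
  assumes "p \<noteq> 0"
  shows "\<exists>t. poly p t \<noteq> 0"
proof (cases "degree p = 0")
  case True
  then obtain c where "p = [:c:]" by (rule degree_eq_zeroE)
  with assms show ?thesis by auto
next
  case False
  have "degree (p - 1) > 0"
  proof (rule ccontr)
    assume "\<not> degree (p - 1) > 0"
    then obtain c where "p - 1 = [:c:]" using degree_eq_zeroE by blast
    then have "p = [:c + 1:]" by (metis add_pCons add_0 diff_add_cancel one_pCons)
    with False show False by simp
  qed
  then obtain t where "poly (p - 1) t = 0"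
    using alg_closed_imp_poly_has_root by blast
  then show ?thesis by (intro exI[of _ t]) simp
qed

text \<open>
  A prime \<open>P\<close> of \<open>A[T]\<close> together with its contraction to \<open>A\<close>, called \<open>Q\<close> below. Both
  parts of the locale are primes, so the facts about primes are available for each of them.
\<close>
locale prime_of_poly_ring =
  base: prime_of_subring A "{c \<in> A. [:c:] \<in> P}" + poly: prime_of_subring "polys_over A" P
  for A :: "'r::comm_ring_1 set" and P :: "'r poly set"
begin

abbreviation "Q \<equiv> {c \<in> A. [:c:] \<in> P}"

lemma const_polys_over: "c \<in> A \<Longrightarrow> [:c:] \<in> polys_over A"
  by (auto simp: polys_over_def coeff_pCons base.zero_A split: nat.splits)

lemma monom_polys_over: "c \<in> A \<Longrightarrow> monom c i \<in> polys_over A"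
  by (auto simp: polys_over_def base.zero_A)

lemma polys_over_Q_subset: "p \<in> polys_over Q \<Longrightarrow> p \<in> P"
proof -
  assume p: "p \<in> polys_over Q"
  have "monom (coeff p i) i \<in> P" for i
  proof -
    have "[:coeff p i:] * monom 1 i \<in> P"
      using p by (intro poly.mult_P' monom_polys_over base.one_A) (auto simp: polys_over_def)
    then show ?thesis by (simp add: smult_monom)
  qed
  then have "(\<Sum>i\<le>degree p. monom (coeff p i) i) \<in> P"
    by (intro poly.sum_P)
  then show ?thesis by (simp add: poly_as_sum_of_monoms)
qed

lemma smult_in_P_iff:
  assumes "c \<in> A" "c \<notin> Q" "p \<in> polys_over A"
  shows "smult c p \<in> P \<longleftrightarrow> p \<in> P"
  using poly.prime_P[of "[:c:]" p] poly.mult_P[of "[:c:]" p] assms const_polys_over by auto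

lemma polys_over_Q_mult:
  assumes "p \<in> polys_over Q" "q \<in> polys_over A"
  shows "p * q \<in> polys_over Q"
  using assms unfolding polys_over_def coeff_mult mem_Collect_eq[of _ "\<lambda>p. \<forall>i. coeff p i \<in> _"]
  by (intro allI base.sum_P base.mult_P') auto

text \<open>
  Dropping leading terms with coefficient in \<open>Q\<close> realises the leading coefficient of the image of
  \<open>p\<close> in \<open>(A/Q)[T]\<close> without forming the quotient.
\<close>
lemma strip_leading_terms:
  assumes "p \<in> polys_over A" "p \<notin> polys_over Q"
  shows "\<exists>p'. p' \<in> polys_over A \<and> p - p' \<in> polys_over Q \<and> degree p' \<le> degree p \<and> lead_coeff p' \<notin> Q"
  using assms
proof (induction "degree p" arbitrary: p rule: less_induct)
  case less
  show ?case
  proof (cases "lead_coeff p \<in> Q")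
    case False
    then show ?thesis
      using less.prems base.zero_P by (intro exI[of _ p]) (auto simp: polys_over_def)
  next
    case True
    define t where "t = monom (lead_coeff p) (degree p)"
    have t: "t \<in> polys_over Q" "t \<in> polys_over A"
      using True base.zero_P by (auto simp: t_def polys_over_def)
    have coeff: "coeff (p - t) i = (if i = degree p then 0 else coeff p i)" for i
      by (simp add: t_def)
    have "p - t \<in> polys_over A"
      using less.prems(1) t by (auto intro: poly.diff_A)
    moreover have nQ: "p - t \<notin> polys_over Q"
    proof
      assume "p - t \<in> polys_over Q"
      then have "\<forall>i. coeff (p - t) i + coeff t i \<in> Q"
        using t(1) base.add_P unfolding polys_over_def by blast
      then show False using less.prems(2) by (simp add: polys_over_def)
    qed
    moreover have deg: "degree (p - t) < degree p"
    proof -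
      have "degree (p - t) \<le> degree p"
        by (rule degree_le) (simp add: coeff coeff_eq_0 del: coeff_diff)
      moreover have "degree (p - t) \<noteq> degree p"
      proof
        assume eq: "degree (p - t) = degree p"
        have "lead_coeff (p - t) = 0" unfolding eq coeff by simp
        then have "p - t = 0" by (rule leading_coeff_0_iff[THEN iffD1])
        then show False using nQ base.zero_P by (simp add: polys_over_def)
      qed
      ultimately show ?thesis by simp
    qed
    ultimately obtain p' where p': "p' \<in> polys_over A" "p - t - p' \<in> polys_over Q"
        "degree p' \<le> degree (p - t)" "lead_coeff p' \<notin> Q"
      using less.hyps[of "p - t"] by blast
    have "coeff (p - t - p') i + coeff t i \<in> Q" for i
      by (rule base.add_P) (use p'(2) t(1) in \<open>auto simp: polys_over_def\<close>)
    then have "p - p' \<in> polys_over Q"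
      by (simp add: polys_over_def)
    then show ?thesis using p' deg by (intro exI[of _ p']) auto
  qed
qed

text \<open>
  If \<open>P\<close> is not just the extension of \<open>Q\<close>, then over the fraction field of \<open>A/Q\<close> it is generated by
  a minimal polynomial \<open>h\<close>. Choosing \<open>h\<close> of least degree in \<open>P\<close> makes denominators explicit: they are
  powers of leading coefficients outside \<open>Q\<close>.
\<close>
context
  fixes h assumes h: "h \<in> P" "lead_coeff h \<notin> Q"
    and h_min: "\<And>p. p \<in> P \<Longrightarrow> lead_coeff p \<notin> Q \<Longrightarrow> degree h \<le> degree p"
begin

lemma h_over_A: "h \<in> polys_over A"
  using h(1) by (rule poly.P_sub_A)

lemma lead_h_in_A: "lead_coeff h ^ m \<in> A"
  using h_over_A by (intro base.power_A) (auto simp: polys_over_def)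

lemma lead_h_notin_Q: "lead_coeff h ^ m \<notin> Q"
  using base.power_in_P_D[of "lead_coeff h" m] h h_over_A by (auto simp: polys_over_def)

lemma degree_h_pos: "degree h > 0"
proof (rule ccontr)
  assume "\<not> degree h > 0"
  then obtain c where "h = [:c:]" using degree_eq_zeroE by blast
  with h h_over_A show False
    by (auto simp: polys_over_def coeff_pCons split: nat.splits)
qed

lemma low_degree_coeffs:
  assumes "p \<in> P" "degree p < degree h"
  shows "p \<in> polys_over Q"
proof (rule ccontr)
  assume "p \<notin> polys_over Q"
  from strip_leading_terms[OF poly.P_sub_A[OF assms(1)] this]
  obtain p' where p': "p - p' \<in> polys_over Q" "degree p' \<le> degree p" "lead_coeff p' \<notin> Q"
    by blast
  then have "p' \<in> P"
    using polys_over_Q_subset poly.in_P_cong assms(1) by blast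
  with h_min p' assms(2) show False by fastforce
qed

text \<open>
  Over the fraction field of \<open>A/Q\<close>, the quotient by \<open>h\<close> is a field, so \<open>s\<close> has an inverse there;
  \<open>u/g\<close> is this inverse with its denominator cleared. It comes from Euclid's algorithm: dividing
  \<open>h\<close> by \<open>s\<close> leaves a remainder of smaller degree. That remainder cannot lie in \<open>P\<close>, since otherwise
  the quotient would lie in \<open>P\<close> too, and by minimality of \<open>h\<close> both would have all coefficients in
  \<open>Q\<close>, which contradicts the choice of \<open>h\<close>.
\<close>
lemma inverse_low_degree:
  assumes "s \<in> polys_over A" "s \<notin> P" "degree s < degree h"
  shows "\<exists>u g. u \<in> polys_over A \<and> g \<in> A \<and> g \<notin> Q \<and> u * s - [:g:] \<in> P"
  using assms
proof (induction "degree s" arbitrary: s rule: less_induct)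
  case less
  have "s \<notin> polys_over Q"
    using less.prems polys_over_Q_subset by blast
  from strip_leading_terms[OF less.prems(1) this] obtain s' where s':
    "s' \<in> polys_over A" "s - s' \<in> polys_over Q" "degree s' \<le> degree s" "lead_coeff s' \<notin> Q"
    by blast
  have ss': "s - s' \<in> P" using s'(2) by (rule polys_over_Q_subset)
  then have s'P: "s' \<notin> P" using less.prems poly.in_P_cong by blast
  have "\<exists>u g. u \<in> polys_over A \<and> g \<in> A \<and> g \<notin> Q \<and> u * s' - [:g:] \<in> P"
  proof (cases "degree s' = 0")
    case True
    then obtain g where g: "s' = [:g:]" by (rule degree_eq_zeroE)
    then have "g \<in> A"
      using s'(1) by (auto simp: polys_over_def dest: spec[of _ 0])
    then show ?thesis
      using g s'P poly.one_A poly.zero_P by (intro exI[of _ 1] exI[of _ g]) auto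
  next
    case False
    from base.pseudo_division[OF s'(1) _ h_over_A] False
    obtain m q r where qr: "q \<in> polys_over A" "r \<in> polys_over A" "degree q \<le> degree h - degree s'"
        "degree r < degree s'" "smult (lead_coeff s' ^ m) h = q * s' + r"
      by blast
    have hP: "q * s' + r \<in> P"
      using poly.mult_P[OF const_polys_over h(1), of "lead_coeff s' ^ m"] base.power_A[of "lead_coeff s'" m] s'(1)
      by (auto simp: polys_over_def simp flip: qr(5))
    have "r \<notin> P"
    proof
      assume r: "r \<in> P"
      then have "q * s' \<in> P" using poly.diff_P[OF hP r] by simp
      then have "q \<in> P" using poly.prime_P qr(1) s'(1) s'P by blast
      moreover have "degree q < degree h"
        using qr(3) False degree_h_pos by linarith
      ultimately have "q * s' \<in> polys_over Q"
        using low_degree_coeffs polys_over_Q_mult s'(1) by blast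
      moreover have "r \<in> polys_over Q"
        using r qr(4) s'(3) less.prems(3) by (intro low_degree_coeffs) auto
      ultimately have "coeff (q * s') (degree h) + coeff r (degree h) \<in> Q"
        by (intro base.add_P) (auto simp: polys_over_def)
      also have "coeff (q * s') (degree h) + coeff r (degree h) = lead_coeff s' ^ m * lead_coeff h"
        by (metis coeff_add coeff_smult qr(5))
      finally have "lead_coeff s' ^ m \<in> Q \<or> lead_coeff h \<in> Q"
        using s'(1) h_over_A by (intro base.prime_P base.power_A) (auto simp: polys_over_def)
      then show False
        using h(2) s'(4) s'(1) base.power_in_P_D[of "lead_coeff s'" m] by (auto simp: polys_over_def)
    qed
    then obtain u g where ug: "u \<in> polys_over A" "g \<in> A" "g \<notin> Q" "u * r - [:g:] \<in> P"
      using less.hyps[of r] qr(2,4) s'(3) less.prems(3) by auto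
    have "u * (q * s' + r) - (u * r - [:g:]) \<in> P"
      by (intro poly.diff_P poly.mult_P ug(1,4) hP)
    moreover have "u * (q * s' + r) - (u * r - [:g:]) = (u * q) * s' - [:- g:]"
      by (simp add: algebra_simps flip: minus_pCons)
    ultimately have "(u * q) * s' - [:- g:] \<in> P"
      by simp
    moreover have "- g \<notin> Q" using ug(3) base.uminus_P[of "- g"] by auto
    ultimately show ?thesis
      using ug qr by (intro exI[of _ "u * q"] exI[of _ "- g"]) (auto intro: poly.mult_A base.uminus_A)
  qed
  then obtain u g where ug: "u \<in> polys_over A" "g \<in> A" "g \<notin> Q" "u * s' - [:g:] \<in> P"
    by blast
  have "u * (s - s') + (u * s' - [:g:]) \<in> P"
    using ug ss' by (intro poly.add_P poly.mult_P)
  then have "u * s - [:g:] \<in> P" by (simp add: algebra_simps)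
  with ug show ?case by blast
qed

text \<open>Pseudo-division by \<open>h\<close> reduces to the case of low degree.\<close>
lemma inverse_mod_P:
  assumes "s \<in> polys_over A" "s \<notin> P"
  shows "\<exists>u g. u \<in> polys_over A \<and> g \<in> A \<and> g \<notin> Q \<and> u * s - [:g:] \<in> P"
proof -
  obtain m q r where qr: "q \<in> polys_over A" "r \<in> polys_over A"
      "degree r < degree h" "smult (lead_coeff h ^ m) s = q * h + r"
    using base.pseudo_division[OF h_over_A degree_h_pos assms(1)] by blast
  define c where "c = lead_coeff h ^ m"
  have c: "c \<in> A" "c \<notin> Q" unfolding c_def by (rule lead_h_in_A, rule lead_h_notin_Q)
  have diff: "smult c s - r \<in> P"
    using qr h(1) by (simp add: c_def poly.mult_P)
  then have "r \<notin> P"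
    using poly.in_P_cong smult_in_P_iff[OF c assms(1)] assms(2) by blast
  then obtain u g where ug: "u \<in> polys_over A" "g \<in> A" "g \<notin> Q" "u * r - [:g:] \<in> P"
    using inverse_low_degree[OF qr(2) _ qr(3)] by blast
  have "u * (smult c s - r) + (u * r - [:g:]) \<in> P"
    using ug diff by (intro poly.add_P poly.mult_P)
  then have "(u * [:c:]) * s - [:g:] \<in> P" by (simp add: algebra_simps)
  moreover have "u * [:c:] \<in> polys_over A"
    using ug c by (intro poly.mult_A const_polys_over)
  ultimately show ?thesis using ug by blast
qed

end

text \<open>
  The geometric content: if \<open>f\<close> does not vanish on the variety of \<open>P\<close>, then the image in the variety
  of \<open>Q\<close> of the locus \<open>f \<noteq> 0\<close> contains the nonempty basic open set \<open>g \<noteq> 0\<close>. If \<open>P\<close> is the extension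
  of \<open>Q\<close>, the fibres are full lines and \<open>g\<close> can be any coefficient of \<open>f\<close> outside \<open>Q\<close>, since it keeps \<open>f\<close> nonzero on the fibre. Otherwise a
  root \<open>t\<close> of the specialised \<open>h\<close> works: where the leading coefficient of \<open>h\<close> does not vanish,
  pseudo-division shows that \<open>t\<close> is a zero of all of \<open>P\<close>, and \<open>u * f \<equiv> g\<close> modulo \<open>P\<close> shows that \<open>f\<close>
  does not vanish there.
\<close>
lemma extend_hom_past_variable:
  assumes f: "f \<in> polys_over A" "f \<notin> P"
  shows "\<exists>g\<in>A. g \<notin> Q \<and> (\<forall>\<phi> :: 'r \<Rightarrow> 'k::alg_closed_field.
      comm_ring_1_hom \<phi> \<longrightarrow> (\<forall>c\<in>Q. \<phi> c = 0) \<longrightarrow> \<phi> g \<noteq> 0 \<longrightarrow>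
      (\<exists>t. (\<forall>p\<in>P. poly (map_poly \<phi> p) t = 0) \<and> poly (map_poly \<phi> f) t \<noteq> 0))"
proof (cases "P \<subseteq> polys_over Q")
  case True
  have "f \<notin> polys_over Q" using f polys_over_Q_subset by blast
  then obtain i where i: "coeff f i \<notin> Q" by (auto simp: polys_over_def)
  show ?thesis
  proof (intro bexI[of _ "coeff f i"] conjI allI impI i)
    show "coeff f i \<in> A" using f by (simp add: polys_over_def)
    fix \<phi> :: "'r \<Rightarrow> 'k"
    assume "comm_ring_1_hom \<phi>" and ker: "\<forall>c\<in>Q. \<phi> c = 0" and nz: "\<phi> (coeff f i) \<noteq> 0"
    then interpret comm_ring_1_hom \<phi> by simp
    have "coeff (map_poly \<phi> f) i \<noteq> 0" using nz by (simp add: coeff_map_poly hom_0)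
    then have "map_poly \<phi> f \<noteq> 0" by (metis coeff_0)
    then obtain t where t: "poly (map_poly \<phi> f) t \<noteq> 0" using alg_closed_nonroot by blast
    have "map_poly \<phi> p = 0" if "p \<in> P" for p
      using that True ker by (intro poly_eqI) (auto simp: coeff_map_poly hom_0 polys_over_def)
    with t show "\<exists>t. (\<forall>p\<in>P. poly (map_poly \<phi> p) t = 0) \<and> poly (map_poly \<phi> f) t \<noteq> 0"
      by (intro exI[of _ t]) simp
  qed
next
  case False
  then obtain p where p: "p \<in> P" "p \<notin> polys_over Q" by blast
  then obtain p' where p': "p - p' \<in> polys_over Q" "lead_coeff p' \<notin> Q"
    using strip_leading_terms poly.P_sub_A by blast
  then have "p' \<in> P" using p(1) polys_over_Q_subset poly.in_P_cong by blast
  then obtain h where h: "h \<in> P" "lead_coeff h \<notin> Q"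
      "\<And>q. q \<in> P \<Longrightarrow> lead_coeff q \<notin> Q \<Longrightarrow> degree h \<le> degree q"
    using p'(2) ex_has_least_nat[of "\<lambda>q. q \<in> P \<and> lead_coeff q \<notin> Q" p' degree] by blast
  obtain u g where ug: "u \<in> polys_over A" "g \<in> A" "g \<notin> Q" "u * f - [:g:] \<in> P"
    using inverse_mod_P[OF h f] by blast
  define c where "c = lead_coeff h"
  have hA: "h \<in> polys_over A" and cA: "c \<in> A" and cQ: "c \<notin> Q"
    using h poly.P_sub_A[OF h(1)] by (auto simp: c_def polys_over_def)
  show ?thesis
  proof (intro bexI[of _ "c * g"] conjI allI impI)
    show "c * g \<in> A" using cA ug by (intro base.mult_A)
    show "c * g \<notin> Q" using base.prime_P cA cQ ug by blast
    fix \<phi> :: "'r \<Rightarrow> 'k"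
    assume "comm_ring_1_hom \<phi>" and ker: "\<forall>c\<in>Q. \<phi> c = 0" and nz: "\<phi> (c * g) \<noteq> 0"
    then interpret comm_ring_1_hom \<phi> by simp
    have nz': "\<phi> c \<noteq> 0" "\<phi> g \<noteq> 0" using nz by (auto simp: hom_mult)
    define ev where "ev p t = poly (map_poly \<phi> p) t" for p t
    have ev_add: "ev (p + q) t = ev p t + ev q t" and ev_mult: "ev (p * q) t = ev p t * ev q t"
      and ev_smult: "ev (smult b p) t = \<phi> b * ev p t" for p q b t
      by (simp_all add: ev_def poly_map_poly_add poly_map_poly_mult poly_map_poly_smult)
    have ev_const: "ev [:b:] t = \<phi> b" for b t
      by (simp add: ev_def map_poly_pCons hom_0)
    have "coeff (map_poly \<phi> h) (degree h) \<noteq> 0"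
      using nz' by (simp add: coeff_map_poly hom_0 c_def)
    then have "degree (map_poly \<phi> h) > 0"
      using le_degree degree_h_pos[OF h] by fastforce
    then obtain t where t: "ev h t = 0"
      unfolding ev_def using alg_closed_imp_poly_has_root by blast
    have P0: "ev p t = 0" if p: "p \<in> P" for p
    proof -
      obtain m q r where qr: "q \<in> polys_over A" "r \<in> polys_over A"
          "degree r < degree h" "smult (c ^ m) p = q * h + r"
        using base.pseudo_division[OF hA degree_h_pos[OF h] poly.P_sub_A[OF p]]
        unfolding c_def by blast
      have "r = [:c ^ m:] * p - q * h" using qr(4) by simp
      also have "\<dots> \<in> P"
        using p h qr cA by (intro poly.diff_P poly.mult_P const_polys_over base.power_A)
      finally have "r \<in> polys_over Q" using low_degree_coeffs[OF h] qr(3) by blast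
      then have "map_poly \<phi> r = 0"
        using ker by (intro poly_eqI) (auto simp: coeff_map_poly hom_0 polys_over_def)
      then have "\<phi> (c ^ m) * ev p t = 0"
        using arg_cong[OF qr(4), of "\<lambda>p. ev p t"] t
        by (simp add: ev_smult ev_add ev_mult) (simp add: ev_def)
      moreover have "\<phi> (c ^ m) \<noteq> 0"
        using nz' by (simp add: hom_power)
      ultimately show ?thesis by simp
    qed
    have "ev (u * f) t = ev (u * f - [:g:] + [:g:]) t" by simp
    also have "\<dots> = \<phi> g" unfolding ev_add using P0[OF ug(4)] ev_const by simp
    finally have "ev f t \<noteq> 0" using nz' by (auto simp: ev_mult)
    with P0 show "\<exists>t. (\<forall>p\<in>P. poly (map_poly \<phi> p) t = 0) \<and> poly (map_poly \<phi> f) t \<noteq> 0"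
      unfolding ev_def by blast
  qed
qed

end

section \<open>The polynomial ring in one more variable\<close>

lemma mpoly_const_closed: "mpoly_const c \<in> carrier (mpoly_ring n)"
  by (simp add: mpoly_const_def mpoly_ring_carrier)

lemma mpoly_var_closed: "i < n \<Longrightarrow> mpoly_var i \<in> carrier (mpoly_ring n)"
  by (simp add: mpoly_var_def mpoly_ring_carrier)

lemma mpoly_ring_mono: "m \<le> n \<Longrightarrow> carrier (mpoly_ring m) \<subseteq> carrier (mpoly_ring n)"
  by (fastforce simp: mpoly_ring_carrier)

lemma mpoly_ring_a_minus:
  fixes p q :: "'k::comm_ring_1 mpoly"
  assumes "p \<in> carrier (mpoly_ring n)" "q \<in> carrier (mpoly_ring n)"
  shows "p \<ominus>\<^bsub>mpoly_ring n\<^esub> q = p - q"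
proof -
  interpret cring "mpoly_ring n :: 'k mpoly ring" by (rule cring_mpoly_ring)
  have "\<ominus>\<^bsub>mpoly_ring n\<^esub> q = - q"
    using l_neg[OF assms(2)] by (simp add: add_eq_0_iff2)
  then show ?thesis by (simp add: a_minus_def)
qed

lemma mpoly_ring_closed:
  fixes p q :: "'k::comm_ring_1 mpoly"
  shows "1 \<in> carrier (mpoly_ring n :: 'k mpoly ring)"
    and "p \<in> carrier (mpoly_ring n) \<Longrightarrow> q \<in> carrier (mpoly_ring n) \<Longrightarrow> p + q \<in> carrier (mpoly_ring n)"
    and "p \<in> carrier (mpoly_ring n) \<Longrightarrow> q \<in> carrier (mpoly_ring n) \<Longrightarrow> p - q \<in> carrier (mpoly_ring n)"
    and "p \<in> carrier (mpoly_ring n) \<Longrightarrow> q \<in> carrier (mpoly_ring n) \<Longrightarrow> p * q \<in> carrier (mpoly_ring n)"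
proof -
  interpret cring "mpoly_ring n :: 'k mpoly ring" by (rule cring_mpoly_ring)
  show "1 \<in> carrier (mpoly_ring n :: 'k mpoly ring)" using one_closed by simp
  show "p \<in> carrier (mpoly_ring n) \<Longrightarrow> q \<in> carrier (mpoly_ring n) \<Longrightarrow> p + q \<in> carrier (mpoly_ring n)"
    using a_closed[of p q] by simp
  show "p \<in> carrier (mpoly_ring n) \<Longrightarrow> q \<in> carrier (mpoly_ring n) \<Longrightarrow> p - q \<in> carrier (mpoly_ring n)"
    using minus_closed[of p q] by (simp add: mpoly_ring_a_minus)
  show "p \<in> carrier (mpoly_ring n) \<Longrightarrow> q \<in> carrier (mpoly_ring n) \<Longrightarrow> p * q \<in> carrier (mpoly_ring n)"
    using m_closed[of p q] by simp
qed

lemma mpoly_ring_ideal_closed: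
  fixes I :: "'k::comm_ring_1 mpoly set"
  assumes "ideal I (mpoly_ring n)"
  shows "0 \<in> I"
    and "p \<in> I \<Longrightarrow> p \<in> carrier (mpoly_ring n)"
    and "p \<in> I \<Longrightarrow> q \<in> I \<Longrightarrow> p + q \<in> I"
    and "p \<in> carrier (mpoly_ring n) \<Longrightarrow> q \<in> I \<Longrightarrow> p * q \<in> I"
proof -
  interpret ideal I "mpoly_ring n" by fact
  have add: "p + q \<in> I" if "p \<in> I" "q \<in> I" for p q
    using additive_subgroup.a_closed[OF is_additive_subgroup that] by simp
  show "0 \<in> I" using additive_subgroup.zero_closed[OF is_additive_subgroup] by simp
  show "p \<in> I \<Longrightarrow> p \<in> carrier (mpoly_ring n)" by (rule Icarr)
  show "p \<in> I \<Longrightarrow> q \<in> I \<Longrightarrow> p + q \<in> I" by (rule add)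
  show "p \<in> carrier (mpoly_ring n) \<Longrightarrow> q \<in> I \<Longrightarrow> p * q \<in> I"
    using I_l_closed[of q p] by simp
qed

lemma primeideal_prime_of_subring:
  fixes P :: "'k::comm_ring_1 mpoly set"
  assumes "primeideal P (mpoly_ring n)"
  shows "prime_of_subring (carrier (mpoly_ring n)) P"
proof -
  interpret primeideal P "mpoly_ring n" by fact
  show ?thesis
  proof
    show "1 \<notin> P" using one_imp_carrier I_notcarr by auto
    show "a \<in> P \<or> b \<in> P"
      if "a \<in> carrier (mpoly_ring n)" "b \<in> carrier (mpoly_ring n)" "a * b \<in> P" for a b
      using I_prime[of a b] that by simp
  qed (simp_all add: mpoly_ring_closed mpoly_ring_ideal_closed[OF is_ideal])
qed

text \<open>
  Every polynomial in \<open>n + 1\<close> variables is a polynomial in the last variable with coefficients in the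
  first \<open>n\<close>. Splitting the last variable off each monomial gives such a representation.
\<close>
lemma monom_Suc_split:
  assumes "Poly_Mapping.keys m \<subseteq> {..<Suc n}"
  shows "\<exists>m'. Poly_Mapping.keys m' \<subseteq> {..<n} \<and> m = m' + Poly_Mapping.single n (Poly_Mapping.lookup m n)"
proof (intro exI conjI)
  let ?m' = "Poly_Mapping.update n 0 m"
  show "Poly_Mapping.keys ?m' \<subseteq> {..<n}"
    using assms by (auto simp: keys_update less_Suc_eq)
  show "m = ?m' + Poly_Mapping.single n (Poly_Mapping.lookup m n)"
    by (rule poly_mapping_eqI) (auto simp: lookup_add lookup_update lookup_single when_def)
qed

lemma mpoly_var_power: "mpoly_var i ^ j = Poly_Mapping.single (Poly_Mapping.single i j) 1"
  by (induction j) (simp_all add: mpoly_var_def mult_single flip: single_add)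

lemma mpoly_ring_Suc_as_poly:
  fixes f :: "'k::comm_ring_1 mpoly"
  assumes "f \<in> carrier (mpoly_ring (Suc n))"
  shows "\<exists>p. p \<in> polys_over (carrier (mpoly_ring n)) \<and> f = poly p (mpoly_var n)"
proof -
  let ?rep = "\<lambda>f. \<exists>p. p \<in> polys_over (carrier (mpoly_ring n)) \<and> f = poly p (mpoly_var n :: 'k mpoly)"
  have add: "?rep (f + g)" if "?rep f" "?rep g" for f g
  proof -
    from that obtain p q where "p \<in> polys_over (carrier (mpoly_ring n))" "f = poly p (mpoly_var n)"
      "q \<in> polys_over (carrier (mpoly_ring n))" "g = poly q (mpoly_var n)" by blast
    then show ?thesis
      by (intro exI[of _ "p + q"]) (auto simp: polys_over_def intro: mpoly_ring_closed)
  qed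
  have zero: "?rep 0"
    by (intro exI[of _ 0]) (auto simp: polys_over_def mpoly_ring_carrier)
  have monom: "?rep (Poly_Mapping.single m c)" if m: "Poly_Mapping.keys m \<subseteq> {..<Suc n}" for m c
  proof -
    obtain m' where m': "Poly_Mapping.keys m' \<subseteq> {..<n}"
        "m = m' + Poly_Mapping.single n (Poly_Mapping.lookup m n)"
      using monom_Suc_split[OF m] by blast
    define p where "p = monom (Poly_Mapping.single m' c) (Poly_Mapping.lookup m n)"
    have "Poly_Mapping.single m' c * mpoly_var n ^ Poly_Mapping.lookup m n = Poly_Mapping.single m c"
      by (subst (2) m'(2)) (simp add: mpoly_var_power mult_single)
    moreover have "p \<in> polys_over (carrier (mpoly_ring n))"
      using m'(1) by (auto simp: p_def polys_over_def mpoly_ring_carrier)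
    ultimately show ?thesis by (intro exI[of _ p]) (simp add: p_def poly_monom)
  qed
  have "?rep (\<Sum>m\<in>M. Poly_Mapping.single m (Poly_Mapping.lookup f m))"
    if "finite M" "M \<subseteq> Poly_Mapping.keys f" for M
    using that
  proof (induction M)
    case empty
    then show ?case using zero by simp
  next
    case (insert m M)
    then have "Poly_Mapping.keys m \<subseteq> {..<Suc n}"
      using assms by (simp add: mpoly_ring_carrier)
    from add[OF monom[OF this] insert.IH] insert show ?case by simp
  qed
  from this[of "Poly_Mapping.keys f"] show ?thesis
    by (simp flip: mpoly_expand[of f])
qed

lemma poly_mpoly_var_closed:
  fixes p :: "'k::comm_ring_1 mpoly poly"
  assumes "p \<in> polys_over (carrier (mpoly_ring n))"
  shows "poly p (mpoly_var n) \<in> carrier (mpoly_ring (Suc n))"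
  using assms
proof (induction p)
  case 0
  then show ?case by (simp add: mpoly_ring_carrier)
next
  case (pCons c p)
  then show ?case
    using mpoly_ring_mono[of n "Suc n"]
    by (auto simp: pCons_polys_over intro!: mpoly_ring_closed mpoly_var_closed)
qed

lemma mpoly_eval_cong:
  assumes "f \<in> carrier (mpoly_ring n)" "\<And>i. i < n \<Longrightarrow> a i = b i"
  shows "mpoly_eval a f = mpoly_eval b f"
  unfolding mpoly_eval_def monom_eval_def
  using assms by (intro sum.cong arg_cong2[of _ _ _ _ "(*)"] prod.cong) (force simp: mpoly_ring_carrier)+

lemma comm_ring_1_hom_mpoly_eval: "comm_ring_1_hom (mpoly_eval a)"
  by unfold_locales simp_all

lemma mpoly_eval_poly_var:
  fixes p :: "'k::comm_ring_1 mpoly poly"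
  assumes "p \<in> polys_over (carrier (mpoly_ring n))"
  shows "mpoly_eval (a(n := t)) (poly p (mpoly_var n)) = poly (map_poly (mpoly_eval a) p) t"
  using assms
proof (induction p)
  case 0
  then show ?case by simp
next
  case (pCons c p)
  interpret comm_ring_1_hom "mpoly_eval a" by (rule comm_ring_1_hom_mpoly_eval)
  have "mpoly_eval (a(n := t)) c = mpoly_eval a c"
    using pCons.prems by (intro mpoly_eval_cong[of c n]) (auto simp: pCons_polys_over)
  with pCons show ?case by (simp add: poly_map_poly_pCons pCons_polys_over del: fun_upd_apply) simp
qed

text \<open>
  The prime is pulled back along the substitution of the last variable for \<open>T\<close>; its contraction to
  constants is then the contraction of the original prime to \<open>n\<close> variables.
\<close>
lemma prime_of_poly_ring_pullback:
  fixes P :: "'k::comm_ring_1 mpoly set"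
  assumes "prime_of_subring (carrier (mpoly_ring (Suc n))) P"
  shows "prime_of_poly_ring (carrier (mpoly_ring n))
      {p \<in> polys_over (carrier (mpoly_ring n)). poly p (mpoly_var n) \<in> P}"
proof -
  let ?A = "carrier (mpoly_ring n :: 'k mpoly ring)"
  interpret prime_of_subring "carrier (mpoly_ring (Suc n))" P by fact
  have sub: "?A \<subseteq> carrier (mpoly_ring (Suc n))" by (rule mpoly_ring_mono) simp
  have base: "prime_of_subring ?A (?A \<inter> P)"
  proof
    show "0 \<in> ?A \<inter> P" using zero_P by (simp add: mpoly_ring_carrier)
    show "a \<in> ?A \<inter> P \<or> b \<in> ?A \<inter> P" if "a \<in> ?A" "b \<in> ?A" "a * b \<in> ?A \<inter> P" for a b
      using that sub prime_P[of a b] by blast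
  qed (use sub in \<open>auto intro: mpoly_ring_closed add_P mult_P one_notin_P simp: one_notin_P\<close>)
  interpret base: prime_of_subring ?A "?A \<inter> P" by (rule base)
  have const: "[:c:] \<in> polys_over ?A \<longleftrightarrow> c \<in> ?A" for c
    using pCons_polys_over[of c 0 ?A] by (simp add: polys_over_def base.zero_A)
  have "{c \<in> ?A. [:c:] \<in> {p \<in> polys_over ?A. poly p (mpoly_var n) \<in> P}} = ?A \<inter> P"
    using const by auto
  moreover have "prime_of_subring (polys_over ?A) {p \<in> polys_over ?A. poly p (mpoly_var n) \<in> P}"
  proof
    show "1 \<in> polys_over ?A"
      by (simp add: one_pCons const base.one_A)
    show "p - q \<in> polys_over ?A" if "p \<in> polys_over ?A" "q \<in> polys_over ?A" for p q
      using that by (simp add: polys_over_def base.diff_A)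
    show mult: "p * q \<in> polys_over ?A" if "p \<in> polys_over ?A" "q \<in> polys_over ?A" for p q
      using that by (rule base.poly_mult_closed)
    show "p + q \<in> {p \<in> polys_over ?A. poly p (mpoly_var n) \<in> P}"
      if "p \<in> {p \<in> polys_over ?A. poly p (mpoly_var n) \<in> P}"
        "q \<in> {p \<in> polys_over ?A. poly p (mpoly_var n) \<in> P}" for p q
      using that by (simp add: polys_over_def base.add_A add_P)
    show "p * q \<in> {p \<in> polys_over ?A. poly p (mpoly_var n) \<in> P}"
      if "p \<in> polys_over ?A" "q \<in> {p \<in> polys_over ?A. poly p (mpoly_var n) \<in> P}" for p q
      using that by (simp add: mult mult_P poly_mpoly_var_closed)
    show "0 \<in> {p \<in> polys_over ?A. poly p (mpoly_var n) \<in> P}"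
      by (simp add: polys_over_def base.zero_A zero_P)
    show "p \<in> {p \<in> polys_over ?A. poly p (mpoly_var n) \<in> P} \<or>
        q \<in> {p \<in> polys_over ?A. poly p (mpoly_var n) \<in> P}"
      if "p \<in> polys_over ?A" "q \<in> polys_over ?A"
        "p * q \<in> {p \<in> polys_over ?A. poly p (mpoly_var n) \<in> P}" for p q
      using that prime_P[of "poly p (mpoly_var n)" "poly q (mpoly_var n)"]
      by (auto simp: poly_mpoly_var_closed)
  qed (auto simp: one_notin_P)
  ultimately show "prime_of_poly_ring ?A {p \<in> polys_over ?A. poly p (mpoly_var n) \<in> P}"
    using base by (simp add: prime_of_poly_ring_def)
qed

section \<open>The Nullstellensatz for prime ideals\<close>

lemma mpoly_ring_0_const:
  assumes "f \<in> carrier (mpoly_ring 0)"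
  shows "\<exists>c. f = mpoly_const c"
proof -
  have "Poly_Mapping.keys f \<subseteq> {0}" using assms by (auto simp: mpoly_ring_carrier)
  then have "f = Poly_Mapping.single 0 (Poly_Mapping.lookup f 0)"
    by (intro poly_mapping_eqI) (auto simp: lookup_single when_def in_keys_iff subset_iff)
  then show ?thesis by (auto simp: mpoly_const_def)
qed

text \<open>
  A point is built one coordinate at a time. The induction carries the element \<open>f\<close> outside the prime
  along, because the extension to the last coordinate is possible only over the open set \<open>g \<noteq> 0\<close>; the
  point with \<open>n\<close> coordinates has to be chosen there.
\<close>
lemma nullstellensatz_prime:
  fixes P :: "'k::alg_closed_field mpoly set"
  assumes "prime_of_subring (carrier (mpoly_ring n)) P" "f \<in> carrier (mpoly_ring n)" "f \<notin> P"
  shows "\<exists>a\<in>V_aff n P. mpoly_eval a f \<noteq> 0"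
  using assms
proof (induction n arbitrary: P f)
  case 0
  interpret prime_of_subring "carrier (mpoly_ring 0)" P by fact
  (* In zero variables the ring is the field of constants, so a prime is the zero ideal. *)
  have const: "p = mpoly_const 0" if p: "p \<in> P" for p
  proof -
    obtain c where c: "p = mpoly_const c"
      using P_sub_A[OF p] mpoly_ring_0_const by blast
    have "mpoly_const (1 / c) * p \<in> P"
      by (intro mult_P mpoly_const_closed p)
    moreover have "mpoly_const (1 / c) * p = 1" if "c \<noteq> 0"
      using that by (simp add: c mpoly_const_def mult_single flip: single_one)
    ultimately have "c = 0" using one_notin_P by metis
    with c show ?thesis by simp
  qed
  obtain c where c: "f = mpoly_const c" using 0 mpoly_ring_0_const by blast
  then have "c \<noteq> 0" using 0 zero_P by (auto simp: mpoly_const_def)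
  moreover have "(\<lambda>_. undefined) \<in> V_aff 0 P"
    using const by (fastforce simp: V_aff_def affine_space_def)
  ultimately show ?case using c by (intro bexI[of _ "\<lambda>_. undefined"]) simp_all
next
  case (Suc n)
  let ?A = "carrier (mpoly_ring n :: 'k mpoly ring)"
  let ?P = "{p \<in> polys_over ?A. poly p (mpoly_var n) \<in> P}"
  interpret prime_of_poly_ring ?A ?P
    by (rule prime_of_poly_ring_pullback) fact
  obtain F where F: "F \<in> polys_over ?A" "f = poly F (mpoly_var n)"
    using mpoly_ring_Suc_as_poly[OF Suc.prems(2)] by blast
  have "F \<notin> ?P" using F Suc.prems(3) by simp
  from extend_hom_past_variable[OF F(1) this, where 'k='k]
  obtain g where g: "g \<in> ?A" "g \<notin> Q" and
    ext: "\<And>\<phi> :: 'k mpoly \<Rightarrow> 'k. comm_ring_1_hom \<phi> \<Longrightarrow> \<forall>c\<in>Q. \<phi> c = 0 \<Longrightarrow> \<phi> g \<noteq> 0 \<Longrightarrow>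
      \<exists>t. (\<forall>p\<in>?P. poly (map_poly \<phi> p) t = 0) \<and> poly (map_poly \<phi> F) t \<noteq> 0"
    by blast
  obtain a where a: "a \<in> V_aff n Q" "mpoly_eval a g \<noteq> 0"
    using Suc.IH[OF base.prime_of_subring_axioms g] by blast
  then obtain t where t: "\<And>p. p \<in> ?P \<Longrightarrow> poly (map_poly (mpoly_eval a) p) t = 0"
      "poly (map_poly (mpoly_eval a) F) t \<noteq> 0"
    using ext[OF comm_ring_1_hom_mpoly_eval[of a]] unfolding V_aff_def by blast
  have "mpoly_eval (a(n := t)) p = 0" if p: "p \<in> P" for p
  proof -
    have "p \<in> carrier (mpoly_ring (Suc n))"
      using Suc.prems(1) p by (rule prime_of_subring.P_sub_A)
    then obtain F' where "F' \<in> polys_over ?A" "p = poly F' (mpoly_var n)"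
      using mpoly_ring_Suc_as_poly by blast
    then show ?thesis using t(1)[of F'] p by (simp add: mpoly_eval_poly_var)
  qed
  moreover have "a(n := t) \<in> affine_space (Suc n)"
    using a(1) by (auto simp: V_aff_def affine_space_def PiE_iff extensional_def)
  ultimately have "a(n := t) \<in> V_aff (Suc n) P"
    by (simp add: V_aff_def)
  moreover have "mpoly_eval (a(n := t)) f \<noteq> 0"
    using t(2) F by (simp add: mpoly_eval_poly_var)
  ultimately show ?case by blast
qed

lemma vanishing_ideal_V_aff_prime:
  fixes P :: "'k::alg_closed_field mpoly set"
  assumes "primeideal P (mpoly_ring n)"
  shows "vanishing_ideal n (V_aff n P) = P"
  using nullstellensatz_prime[OF primeideal_prime_of_subring[OF assms]]
    mpoly_ring_ideal_closed(2)[OF primeideal.axioms(1)[OF assms]]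
  unfolding vanishing_ideal_def by (auto simp: V_aff_def)

section \<open>Closure in the Zariski topology\<close>

lemma topspace_zariski: "topspace (zariski n :: (nat \<Rightarrow> 'k::idom) topology) = affine_space n"
proof
  let ?A = "affine_space n :: (nat \<Rightarrow> 'k) set"
  interpret cring "mpoly_ring n :: 'k mpoly ring" by (rule cring_mpoly_ring)
  have "V_aff n (carrier (mpoly_ring n) :: 'k mpoly set) = {}"
    using mpoly_ring_closed(1)[of n, where 'k='k] mpoly_eval_one unfolding V_aff_def
    by (metis (mono_tags, lifting) Collect_empty_eq zero_neq_one)
  then have "openin (zariski n) ?A"
    using oneideal unfolding openin_zariski by (intro exI[of _ "carrier (mpoly_ring n)"]) simp
  then show "?A \<subseteq> topspace (zariski n)" by (rule openin_subset)
  have "openin (zariski n :: (nat \<Rightarrow> 'k) topology) (topspace (zariski n))" by simp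
  then show "topspace (zariski n) \<subseteq> ?A" unfolding openin_zariski by blast
qed

lemma closedin_zariski:
  fixes C :: "(nat \<Rightarrow> 'k::idom) set"
  shows "closedin (zariski n) C \<longleftrightarrow> (\<exists>I. ideal I (mpoly_ring n) \<and> C = V_aff n I)"
proof -
  have "C \<subseteq> affine_space n \<and> affine_space n - C = affine_space n - V_aff n I \<longleftrightarrow> C = V_aff n I" for I
    unfolding V_aff_def by blast
  then show ?thesis
    unfolding closedin_def topspace_zariski openin_zariski by metis
qed

lemma zariski_closure_of:
  fixes Y :: "(nat \<Rightarrow> 'k::idom) set"
  assumes "Y \<subseteq> affine_space n"
  shows "zariski n closure_of Y = V_aff n (vanishing_ideal n Y)"
proof
  have "closedin (zariski n) (V_aff n (vanishing_ideal n Y))"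
    unfolding closedin_zariski using ideal_vanishing_ideal by blast
  moreover have "Y \<subseteq> V_aff n (vanishing_ideal n Y)"
    using assms by (auto simp: V_aff_def vanishing_ideal_def)
  ultimately show "zariski n closure_of Y \<subseteq> V_aff n (vanishing_ideal n Y)"
    by (intro closure_of_minimal)
  obtain I where I: "ideal I (mpoly_ring n)" "zariski n closure_of Y = V_aff n I"
    using closedin_closure_of[of "zariski n" Y] unfolding closedin_zariski by blast
  have "Y \<subseteq> V_aff n I"
    using closure_of_subset[of Y "zariski n"] assms I by (simp add: topspace_zariski)
  then have "I \<subseteq> vanishing_ideal n Y"
    using mpoly_ring_ideal_closed(2)[OF I(1)] by (auto simp: V_aff_def vanishing_ideal_def)
  then show "V_aff n (vanishing_ideal n Y) \<subseteq> zariski n closure_of Y"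
    unfolding I(2) by (auto simp: V_aff_def)
qed

lemma vanishing_ideal_zariski_closure:
  fixes Y :: "(nat \<Rightarrow> 'k::idom) set"
  assumes "Y \<subseteq> affine_space n"
  shows "vanishing_ideal n (zariski n closure_of Y) = vanishing_ideal n Y"
  unfolding zariski_closure_of[OF assms] using assms
  by (auto simp: V_aff_def vanishing_ideal_def)

section \<open>Powers of point ideals\<close>

text \<open>
  The identity \<open>xg - a\<^sub>j g(a) = x (g - g(a)) + g(a) (x - a\<^sub>j)\<close> with \<open>x = x\<^sub>j\<close> drives a Horner-style induction
  on a polynomial in the last variable. The number \<open>j\<close> of variables of \<open>f\<close> varies, but the ideal
  stays that of the point in \<open>n\<close>-space.
\<close>
lemma diff_const_in_point_ideal:
  fixes f :: "'k::comm_ring_1 mpoly"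
  assumes "f \<in> carrier (mpoly_ring j)" "j \<le> n"
  shows "f - mpoly_const (mpoly_eval a f) \<in> point_ideal n a"
  using assms
proof (induction j arbitrary: f)
  have gens: "(\<lambda>i. mpoly_var i - mpoly_const (a i)) ` {..<n} \<subseteq> carrier (mpoly_ring n)"
    by (auto intro: mpoly_ring_closed mpoly_var_closed mpoly_const_closed)
  interpret cring "mpoly_ring n :: 'k mpoly ring" by (rule cring_mpoly_ring)
  have ideal: "ideal (point_ideal n a) (mpoly_ring n)"
    unfolding point_ideal_def by (rule genideal_ideal[OF gens])
  note closed = mpoly_ring_ideal_closed[OF ideal]
  {
    case 0
    then show ?case using mpoly_ring_0_const[of f] closed(1) by auto
  next
    case (Suc j)
    have var: "mpoly_var j - mpoly_const (a j) \<in> point_ideal n a"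
      unfolding point_ideal_def using genideal_self[OF gens] Suc.prems(2) by auto
    obtain p where p: "p \<in> polys_over (carrier (mpoly_ring j))" "f = poly p (mpoly_var j)"
      using mpoly_ring_Suc_as_poly[OF Suc.prems(1)] by blast
    show ?case
      unfolding p(2) using p(1)
    proof (induction p)
      case 0
      then show ?case using closed(1) by (simp add: mpoly_const_def)
    next
      case (pCons c p)
      let ?x = "mpoly_var j :: 'k mpoly" and ?g = "poly p (mpoly_var j)"
      let ?val = "\<lambda>f. mpoly_const (mpoly_eval a f) :: 'k mpoly"
      have "(c - ?val c) + (?x * (?g - ?val ?g) + ?val ?g * (?x - mpoly_const (a j))) \<in> point_ideal n a"
        using pCons.prems Suc.prems(2)
        by (intro closed(3,4) var mpoly_var_closed mpoly_const_closed pCons.IH Suc.IH)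
           (auto simp: pCons_polys_over)
      also have "(c - ?val c) + (?x * (?g - ?val ?g) + ?val ?g * (?x - mpoly_const (a j))) =
          poly (pCons c p) ?x - ?val (poly (pCons c p) ?x)"
        by (simp add: algebra_simps mpoly_const_def mult_single single_add)
      finally show ?case .
    qed
  }
qed

lemma point_ideal_eq_vanishing_ideal: "point_ideal n a = vanishing_ideal n {a}"
proof
  interpret cring "mpoly_ring n :: 'a mpoly ring" by (rule cring_mpoly_ring)
  show "point_ideal n a \<subseteq> vanishing_ideal n {a}"
    unfolding point_ideal_def
    by (intro genideal_minimal ideal_vanishing_ideal)
       (auto simp: vanishing_ideal_def intro: mpoly_ring_closed mpoly_var_closed mpoly_const_closed)
  show "vanishing_ideal n {a} \<subseteq> point_ideal n a"
  proof
    fix f assume "f \<in> vanishing_ideal n {a}"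
    then show "f \<in> point_ideal n a"
      using diff_const_in_point_ideal[of f n n a] by (simp add: vanishing_ideal_def mpoly_const_def)
  qed
qed

lemma (in cring) ideal_pow_ideal:
  assumes "ideal I R"
  shows "ideal (I [^]\<^bsub>ideals_set R\<^esub> (k::nat)) R"
proof (induction k)
  case 0
  then show ?case using oneideal by (simp add: ideals_set_def)
next
  case (Suc k)
  then show ?case using ideal_prod_is_ideal[OF _ assms] by (simp add: ideals_set_def)
qed

lemma (in cring) ideal_pow_subset:
  assumes "ideal I R" "k > 0"
  shows "I [^]\<^bsub>ideals_set R\<^esub> (k::nat) \<subseteq> I"
proof -
  obtain l where l: "k = Suc l" using assms(2) gr0_implies_Suc by blast
  have "I [^]\<^bsub>ideals_set R\<^esub> k = (I [^]\<^bsub>ideals_set R\<^esub> l) \<cdot> I"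
    unfolding l by (simp add: ideals_set_def)
  also have "\<dots> \<subseteq> I"
    using ideal_prod_inter[OF ideal_pow_ideal[OF assms(1)] assms(1)] by blast
  finally show ?thesis .
qed

text \<open>
  The exponent \<open>N\<close> may exceed \<open>k\<close>, so that one power of \<open>f\<close> serves for a whole family of exponents
  bounded by \<open>N\<close>.
\<close>
lemma power_in_ideal_pow:
  fixes f :: "'k::comm_ring_1 mpoly"
  assumes I: "ideal I (mpoly_ring n)" and f: "f \<in> I" and "k \<le> N"
  shows "f ^ N \<in> I [^]\<^bsub>ideals_set (mpoly_ring n)\<^esub> (k::nat)"
proof -
  interpret cring "mpoly_ring n :: 'k mpoly ring" by (rule cring_mpoly_ring)
  have fc: "f ^ m \<in> carrier (mpoly_ring n)" for m
    using mpoly_ring_ideal_closed(2)[OF I f] by (induction m) (auto intro: mpoly_ring_closed)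
  have "f ^ k \<in> I [^]\<^bsub>ideals_set (mpoly_ring n)\<^esub> k"
  proof (induction k)
    case 0
    then show ?case by (simp add: ideals_set_def mpoly_ring_closed)
  next
    case (Suc k)
    then show ?case
      using ideal_prod.prod[of "f ^ k" _ f I "mpoly_ring n"] f
      by (simp add: ideals_set_def mult.commute)
  qed
  then have "f ^ (N - k) * f ^ k \<in> I [^]\<^bsub>ideals_set (mpoly_ring n)\<^esub> k"
    by (intro mpoly_ring_ideal_closed(4)[OF ideal_pow_ideal[OF I]] fc)
  then show ?thesis using assms(3) by (simp flip: power_add)
qed

section \<open>Primes fixed by the closure operator\<close>

lemma mem_Phi_star:
  "f \<in> Phi_star n X \<nu> A \<longleftrightarrow> f \<in> carrier (mpoly_ring n) \<and>
     (\<forall>a\<in>X. \<exists>p\<in>A. \<exists>q\<in>point_ideal n a [^]\<^bsub>ideals_set (mpoly_ring n)\<^esub> \<nu> a. f = p + q)"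
  by (auto simp: Phi_star_def set_add_def')

lemma subset_Phi_star:
  fixes P :: "'k::comm_ring_1 mpoly set"
  assumes "ideal P (mpoly_ring n)"
  shows "P \<subseteq> Phi_star n X \<nu> P"
proof -
  interpret cring "mpoly_ring n :: 'k mpoly ring" by (rule cring_mpoly_ring)
  have "0 \<in> point_ideal n a [^]\<^bsub>ideals_set (mpoly_ring n)\<^esub> \<nu> a" for a :: "nat \<Rightarrow> 'k"
    unfolding point_ideal_eq_vanishing_ideal
    by (rule mpoly_ring_ideal_closed(1)[OF ideal_pow_ideal[OF ideal_vanishing_ideal]])
  then show ?thesis
    unfolding mem_Phi_star subset_iff
    using mpoly_ring_ideal_closed(2)[OF assms] by (metis add.right_neutral)
qed

lemma Phi_star_subset_vanishing_ideal:
  fixes P :: "'k::comm_ring_1 mpoly set"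
  assumes "\<forall>a\<in>X. \<nu> a > 0"
  shows "Phi_star n X \<nu> P \<subseteq> vanishing_ideal n (X \<inter> V_aff n P)"
proof
  interpret cring "mpoly_ring n :: 'k mpoly ring" by (rule cring_mpoly_ring)
  fix f assume f: "f \<in> Phi_star n X \<nu> P"
  have "mpoly_eval a f = 0" if a: "a \<in> X" "a \<in> V_aff n P" for a
  proof -
    obtain p q where "p \<in> P" "q \<in> point_ideal n a [^]\<^bsub>ideals_set (mpoly_ring n)\<^esub> \<nu> a" "f = p + q"
      using f a(1) unfolding mem_Phi_star by blast
    moreover have "point_ideal n a [^]\<^bsub>ideals_set (mpoly_ring n)\<^esub> \<nu> a \<subseteq> vanishing_ideal n {a}"
      unfolding point_ideal_eq_vanishing_ideal
      using assms a(1) by (intro ideal_pow_subset ideal_vanishing_ideal) auto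
    ultimately show ?thesis using a(2) by (auto simp: vanishing_ideal_def V_aff_def)
  qed
  then show "f \<in> vanishing_ideal n (X \<inter> V_aff n P)"
    using f unfolding mem_Phi_star vanishing_ideal_def by blast
qed

text \<open>
  Off its zero locus, an ideal is comaximal with every power of the ideal of the point: it contains
  some \<open>h\<close> with \<open>h(a) = 1\<close>, and \<open>(1 - h)\<^sup>k\<close> is congruent to \<open>1\<close> modulo the ideal while it lies in the
  \<open>k\<close>-th power.
\<close>
lemma ideal_add_point_power_full:
  fixes P :: "'k::field mpoly set"
  assumes P: "ideal P (mpoly_ring n)" and a: "a \<in> affine_space n" "a \<notin> V_aff n P"
    and f: "f \<in> carrier (mpoly_ring n)"
  shows "\<exists>p\<in>P. \<exists>q\<in>point_ideal n a [^]\<^bsub>ideals_set (mpoly_ring n)\<^esub> (k::nat). f = p + q"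
proof -
  interpret cring "mpoly_ring n :: 'k mpoly ring" by (rule cring_mpoly_ring)
  obtain g where g: "g \<in> P" "mpoly_eval a g \<noteq> 0"
    using a by (auto simp: V_aff_def)
  define h where "h = mpoly_const (1 / mpoly_eval a g) * g"
  have h: "h \<in> P" "mpoly_eval a h = 1"
    using g by (auto simp: h_def intro: mpoly_ring_ideal_closed(4)[OF P] mpoly_const_closed)
  have hc: "h \<in> carrier (mpoly_ring n)" using mpoly_ring_ideal_closed(2)[OF P h(1)] .
  then have "1 - h \<in> point_ideal n a"
    using h(2) by (simp add: point_ideal_eq_vanishing_ideal vanishing_ideal_def mpoly_ring_closed)
  moreover have ideal: "ideal (point_ideal n a) (mpoly_ring n)"
    unfolding point_ideal_eq_vanishing_ideal by (rule ideal_vanishing_ideal)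
  ultimately have pow: "(1 - h) ^ k \<in> point_ideal n a [^]\<^bsub>ideals_set (mpoly_ring n)\<^esub> k"
    by (intro power_in_ideal_pow) simp_all
  have "1 - (1 - h) ^ k \<in> P"
  proof (induction k)
    case 0
    then show ?case using mpoly_ring_ideal_closed(1)[OF P] by simp
  next
    case (Suc k)
    have "(1 - h) * (1 - (1 - h) ^ k) + h \<in> P"
      using Suc h hc by (intro mpoly_ring_ideal_closed(3,4)[OF P] mpoly_ring_closed)
    then show ?case by (simp add: algebra_simps)
  qed
  then have "f * (1 - (1 - h) ^ k) \<in> P"
    using mpoly_ring_ideal_closed(4)[OF P f] by blast
  moreover have "f * (1 - h) ^ k \<in> point_ideal n a [^]\<^bsub>ideals_set (mpoly_ring n)\<^esub> k"
    by (rule mpoly_ring_ideal_closed(4)[OF ideal_pow_ideal[OF ideal] f pow])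
  ultimately show ?thesis
    by (intro bexI[of _ "f * (1 - (1 - h) ^ k)"] bexI[of _ "f * (1 - h) ^ k"]) (simp_all add: algebra_simps)
qed

text \<open>
  At the points of \<open>X\<close> on the variety, \<open>f\<close> lies in the ideal of the point; boundedness of \<open>\<nu>\<close> lets the
  single power \<open>f\<^sup>N\<close> lie in the required power of that ideal for all these points at once. By
  comaximality, the points off the variety impose no condition.
\<close>
lemma vanishing_ideal_power_in_Phi_star:
  fixes P :: "'k::field mpoly set"
  assumes P: "ideal P (mpoly_ring n)" and X: "X \<subseteq> affine_space n" and N: "\<forall>a\<in>X. \<nu> a \<le> N"
    and f: "f \<in> vanishing_ideal n (X \<inter> V_aff n P)"
  shows "f ^ N \<in> Phi_star n X \<nu> P"
  unfolding mem_Phi_star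
proof (intro conjI ballI)
  have fc: "f \<in> carrier (mpoly_ring n)" using f by (simp add: vanishing_ideal_def)
  show fN: "f ^ N \<in> carrier (mpoly_ring n)"
    using fc by (induction N) (auto intro: mpoly_ring_closed)
  fix a assume a: "a \<in> X"
  show "\<exists>p\<in>P. \<exists>q\<in>point_ideal n a [^]\<^bsub>ideals_set (mpoly_ring n)\<^esub> \<nu> a. f ^ N = p + q"
  proof (cases "a \<in> V_aff n P")
    case True
    then have "f \<in> point_ideal n a"
      using f a by (simp add: point_ideal_eq_vanishing_ideal vanishing_ideal_def)
    then have "f ^ N \<in> point_ideal n a [^]\<^bsub>ideals_set (mpoly_ring n)\<^esub> \<nu> a"
      using N a unfolding point_ideal_eq_vanishing_ideal
      by (intro power_in_ideal_pow ideal_vanishing_ideal) auto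
    then show ?thesis
      using mpoly_ring_ideal_closed(1)[OF P] by (intro bexI[of _ 0] bexI[of _ "f ^ N"]) auto
  next
    case False
    then show ?thesis using ideal_add_point_power_full[OF P _ False fN] X a by blast
  qed
qed

lemma Phi_star_fixed_iff:
  fixes P :: "'k::field mpoly set"
  assumes P: "primeideal P (mpoly_ring n)" and X: "X \<subseteq> affine_space n"
    and "\<forall>a\<in>X. \<nu> a > 0" and "\<exists>N>0. \<forall>a\<in>X. \<nu> a \<le> N"
  shows "Phi_star n X \<nu> P = P \<longleftrightarrow> vanishing_ideal n (X \<inter> V_aff n P) = P"
proof -
  have ideal: "ideal P (mpoly_ring n)" using P by (rule primeideal.axioms)
  interpret prime_of_subring "carrier (mpoly_ring n)" P
    using P by (rule primeideal_prime_of_subring)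
  obtain N where N: "\<forall>a\<in>X. \<nu> a \<le> N" using assms(4) by blast
  have sub: "P \<subseteq> Phi_star n X \<nu> P" "Phi_star n X \<nu> P \<subseteq> vanishing_ideal n (X \<inter> V_aff n P)"
    using subset_Phi_star[OF ideal] Phi_star_subset_vanishing_ideal[OF assms(3)] by auto
  have "vanishing_ideal n (X \<inter> V_aff n P) \<subseteq> P" if "Phi_star n X \<nu> P = P"
  proof
    fix f assume f: "f \<in> vanishing_ideal n (X \<inter> V_aff n P)"
    then have "f ^ N \<in> P"
      using vanishing_ideal_power_in_Phi_star[OF ideal X N] that by blast
    moreover have "f \<in> carrier (mpoly_ring n)" using f by (simp add: vanishing_ideal_def)
    ultimately show "f \<in> P" using power_in_P_D by blast
  qed
  with sub show ?thesis by blast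
qed

text \<open>
  A set and its closure have the same vanishing ideal, and the Nullstellensatz recovers \<open>P\<close> from its
  variety.
\<close>
lemma vanishing_ideal_eq_iff_closure_eq:
  fixes P :: "'k::alg_closed_field mpoly set"
  assumes P: "primeideal P (mpoly_ring n)"
  shows "vanishing_ideal n (X \<inter> V_aff n P) = P \<longleftrightarrow>
    zariski n closure_of (X \<inter> V_aff n P) = V_aff n P"
proof
  have sub: "X \<inter> V_aff n P \<subseteq> affine_space n" by (auto simp: V_aff_def)
  show "zariski n closure_of (X \<inter> V_aff n P) = V_aff n P"
    if "vanishing_ideal n (X \<inter> V_aff n P) = P"
    using zariski_closure_of[OF sub] that by simp
  show "vanishing_ideal n (X \<inter> V_aff n P) = P"
    if "zariski n closure_of (X \<inter> V_aff n P) = V_aff n P"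
    using vanishing_ideal_zariski_closure[OF sub] vanishing_ideal_V_aff_prime[OF P] that by simp
qed

text \<open>
  The variety is closed, so density in its subspace topology can be tested by the closure in affine
  space.
\<close>
lemma zariski_dense_in_V_aff_iff:
  fixes I :: "'k::idom mpoly set"
  assumes "ideal I (mpoly_ring n)"
  shows "zariski_dense_in n (X \<inter> V_aff n I) (V_aff n I) \<longleftrightarrow>
    zariski n closure_of (X \<inter> V_aff n I) = V_aff n I"
proof -
  have "closedin (zariski n) (V_aff n I)"
    unfolding closedin_zariski using assms by blast
  then have "zariski n closure_of (X \<inter> V_aff n I) \<subseteq> V_aff n I"
    by (intro closure_of_minimal) auto
  then show ?thesis
    by (auto simp: zariski_dense_in_def closure_of_subtopology Int_absorb1 Int_commute Int_left_commute)
qed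

theorem theorem5p6:
  fixes n :: nat
    and X :: "(nat \<Rightarrow> 'k::alg_closed_field) set"
    and \<nu> :: "(nat \<Rightarrow> 'k) \<Rightarrow> nat"
  assumes "X \<subseteq> affine_space n"
    and "\<forall>a\<in>X. \<nu> a > 0"
    and "\<exists>N>0. \<forall>a\<in>X. \<nu> a \<le> N"
  shows "(\<forall>P\<in>Spec (mpoly_ring n :: 'k mpoly ring).
            (Phi_star n X \<nu> P = P \<longleftrightarrow> vanishing_ideal n (X \<inter> V_aff n P) = P) \<and>
            (vanishing_ideal n (X \<inter> V_aff n P) = P \<longleftrightarrow>
               zariski n closure_of (X \<inter> V_aff n P) = V_aff n P)) \<and>
         Spec_Phi n X \<nu> =
           {P \<in> Spec (mpoly_ring n). zariski_dense_in n (X \<inter> V_aff n P) (V_aff n P)}"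
proof -
  have fixed: "Phi_star n X \<nu> P = P \<longleftrightarrow> vanishing_ideal n (X \<inter> V_aff n P) = P"
    and closure: "vanishing_ideal n (X \<inter> V_aff n P) = P \<longleftrightarrow>
      zariski n closure_of (X \<inter> V_aff n P) = V_aff n P"
    and dense: "zariski_dense_in n (X \<inter> V_aff n P) (V_aff n P) \<longleftrightarrow>
      zariski n closure_of (X \<inter> V_aff n P) = V_aff n P"
    if "P \<in> Spec (mpoly_ring n)" for P :: "'k mpoly set"
  proof -
    have P: "primeideal P (mpoly_ring n)" using that by (simp add: Spec_def)
    show "Phi_star n X \<nu> P = P \<longleftrightarrow> vanishing_ideal n (X \<inter> V_aff n P) = P"
      by (rule Phi_star_fixed_iff[OF P assms])
    show "vanishing_ideal n (X \<inter> V_aff n P) = P \<longleftrightarrow>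
        zariski n closure_of (X \<inter> V_aff n P) = V_aff n P"
      by (rule vanishing_ideal_eq_iff_closure_eq[OF P])
    show "zariski_dense_in n (X \<inter> V_aff n P) (V_aff n P) \<longleftrightarrow>
        zariski n closure_of (X \<inter> V_aff n P) = V_aff n P"
      by (rule zariski_dense_in_V_aff_iff[OF primeideal.axioms(1)[OF P]])
  qed
  then have "Spec_Phi n X \<nu> =
      {P \<in> Spec (mpoly_ring n). zariski_dense_in n (X \<inter> V_aff n P) (V_aff n P)}"
    unfolding Spec_Phi_def by (intro Collect_cong conj_cong refl) simp_all
  with fixed closure show ?thesis by simp
qed

end
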